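(* The values of $\rho$ listed in (A) and (B) below carry at least the indicated number of distinct genuine pairs, namely the listed pairs $(T,I)$ (each triangle given by its side lengths, $T$ being the $\theta$-triangle and $I$ the isosceles triangle). For each $\rho$ in list (A), the corresponding $\theta$-triangles are pairwise non-congruent, while for each $\rho$ in list (B) one $\theta$-triangle is shared by two distinct isosceles partners (here the pairs are compared after rescaling them to a common perimeter). (A) $\rho=\frac{1952}{3977}$ (at least 6 pairs): $\bigl((12064,86193,91471),(10764,89482,89482)\bigr)$, $\bigl((3977,4215,4352),(3960,4292,4292)\bigr)$, $\bigl((1261,1299,1312),(1260,1306,1306)\bigr)$, $\bigl((970,984,986),(975,975,990)\bigr)$, $\bigl((7178,8010,8528),(7529,7529,8658)\bigr)$, $\bigl((14145,21089,24056),(17225,17225,24840)\bigr)$. $\rho=\frac{613}{1495}$ (at least 5 pairs): $\bigl((1058,1533,1625),(1050,1583,1583)\bigr)$, $\bigl((525,598,613),(553,553,630)\bigr)$, $\bigl((598,750,760),(655,655,798)\bigr)$, $\bigl((299,389,400),(334,334,420)\bigr)$, $\bigl((299,805,880),(530,530,924)\bigr)$. $\rho=\frac{817}{1969}$ (at least 5 pairs): $\bigl((1268608,1406403,1451453),(1322928,1322928,1480608)\bigr)$, $\bigl((1634,1969,1969),(1754,1754,2064)\bigr)$, $\bigl((1122,2123,2327),(1562,1562,2448)\bigr)$, $\bigl((57101,138774,152375),(94085,94085,160080)\bigr)$, $\bigl((1029,1804,1969),(1008,1897,1897)\bigr)$. $\rho=\frac{7671}{16121}$ (at least 5 pairs):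 $\bigl((4823,73826,75999),(4290,75179,75179)\bigr)$, $\bigl((3773,4034,4089),(3770,4063,4063)\bigr)$, $\bigl((1960,1974,2014),(1950,1999,1999)\bigr)$, $\bigl((123850881,329543125,369951946),(219139063,219139063,385067826)\bigr)$, $\bigl((31311875,32603571,32739554),(31771675,31771675,33111650)\bigr)$. $\rho=\frac{302}{527}$ (at least 5 pairs): $\bigl((2108,2787,3395),(1940,3175,3175)\bigr)$, $\bigl((578,1250,1488),(893,893,1530)\bigr)$, $\bigl((8385,8959,9184),(8364,9082,9082)\bigr)$, $\bigl((8160,8479,9889),(8314,8314,9900)\bigr)$, $\bigl((855117,871133,1007500),(807300,963225,963225)\bigr)$. (B) $\rho=\frac{2619}{5069}$ (at least 6 pairs): $\bigl((822,1394,1628),(770,1537,1537)\bigr)$, $\bigl((411,697,814),(541,541,840)\bigr)$, $\bigl((555,4397,4658),(2425,2425,4760)\bigr)$, $\bigl((2270333,2297216,2320899),(2266824,2310812,2310812)\bigr)$, $\bigl((2322,24227,25345),(13047,13047,25800)\bigr)$, $\bigl((1378768,1532129,1689039),(1346268,1626834,1626834)\bigr)$. $\rho=-\frac{327}{1241}$ (at least 5 pairs): $\bigl((612,1387,1657),(532,1562,1562)\bigr)$, $\bigl((219,289,406),(168,373,373)\bigr)$, $\bigl((219,289,406),(253,253,408)\bigr)$, $\bigl((4891,8721,11066),(6711,6711,11256)\bigr)$, $\bigl((73,408,433),(233,233,448)\bigr)$. $\rho=\frac{2341}{4141}$ (at least 5 pairs): $\bigl((1681,2175,2626),(1560,2461,2461)\bigr)$,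 $\bigl((3362,4350,5252),(3817,3817,5330)\bigr)$, $\bigl((295,303,328),(288,319,319)\bigr)$, $\bigl((1066,2487,2929),(1733,1733,3016)\bigr)$, $\bigl((1704375,1963667,2334458),(1824725,1824725,2353050)\bigr)$. $\rho=\frac{171}{221}$ (at least 5 pairs): $\bigl((25,34,39),(24,37,37)\bigr)$, $\bigl((25,34,39),(29,29,40)\bigr)$, $\bigl((173,195,272),(140,250,250)\bigr)$, $\bigl((43289,59895,67184),(50534,50534,69300)\bigr)$, $\bigl((701250,816877,1228123),(758225,758225,1229800)\bigr)$.
   Context: A rational triangle is a triangle with rational side lengths (its area need not be rational). For $\rho\in\mathbb{Q}\cap(-1,1)$ let $\theta\in(0,\pi)$ be the angle with $\cos\theta=\rho$; a rational triangle having an angle equal to $\theta$ is called a $\theta$-triangle. A genuine pair for $\rho$ is a pair $(T,I)$ of non-degenerate rational triangles such that $T$ is a $\theta$-triangle, $I$ is isosceles, $T$ and $I$ have the same perimeter and the same area, and $T$ and $I$ are not congruent; $I$ is then an isosceles partner of $T$. Genuine pairs are counted up to homothety: $(T,I)$ and $(T',I')$ are regarded as the same pair if there is a common scaling factor $\mu>0$ such that $T'$ is congruent to $\mu T$ and $I'$ is congruent to $\mu I$; otherwise they are distinct. The two triangles of each listed pair are at a common scale, but different pairs may be at different scales. *)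

theory Defs
  imports "HOL-Analysis.Analysis" "HOL-Library.Multiset"
begin

text \<open>A triangle is the triple of its vertices in the Euclidean plane; the order of the
  vertices is immaterial to all the notions below.\<close>

type_synonym triangle = "(real ^ 2) \<times> (real ^ 2) \<times> (real ^ 2)"

fun nondegenerate :: "triangle \<Rightarrow> bool" where
  "nondegenerate (A, B, C) \<longleftrightarrow> \<not> collinear {A, B, C}"

fun side_lengths :: "triangle \<Rightarrow> real multiset" where
  "side_lengths (A, B, C) = {#dist A B, dist B C, dist C A#}"

fun perimeter :: "triangle \<Rightarrow> real" where
  "perimeter (A, B, C) = dist A B + dist B C + dist C A"

fun area :: "triangle \<Rightarrow> real" where
  "area (A, B, C) = measure lborel (convex hull {A, B, C})"

definition angle_at :: "real ^ 2 \<Rightarrow> real ^ 2 \<Rightarrow> real ^ 2 \<Rightarrow> real" where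
  "angle_at A B C = arccos (((B - A) \<bullet> (C - A)) / (norm (B - A) * norm (C - A)))"

fun has_angle :: "real \<Rightarrow> triangle \<Rightarrow> bool" where
  "has_angle \<theta> (A, B, C) \<longleftrightarrow> \<theta> \<in> {angle_at A B C, angle_at B C A, angle_at C A B}"

fun isosceles :: "triangle \<Rightarrow> bool" where
  "isosceles (A, B, C) \<longleftrightarrow>
     dist A B = dist A C \<or> dist B C = dist B A \<or> dist C A = dist C B"

fun vertices :: "triangle \<Rightarrow> (real ^ 2) set" where
  "vertices (A, B, C) = {A, B, C}"

text \<open>The isometry of the plane may reverse the orientation.\<close>

definition congruent_triangles :: "triangle \<Rightarrow> triangle \<Rightarrow> bool" where
  "congruent_triangles T T' \<longleftrightarrow>
     (\<exists>f :: real ^ 2 \<Rightarrow> real ^ 2.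
        (\<forall>x y. dist (f x) (f y) = dist x y) \<and> f ` vertices T = vertices T')"

fun scale_triangle :: "real \<Rightarrow> triangle \<Rightarrow> triangle" where
  "scale_triangle \<mu> (A, B, C) = (\<mu> *\<^sub>R A, \<mu> *\<^sub>R B, \<mu> *\<^sub>R C)"

definition rescale_to_perimeter :: "real \<Rightarrow> triangle \<Rightarrow> triangle" where
  "rescale_to_perimeter p T = scale_triangle (p / perimeter T) T"

definition rational_triangle :: "triangle \<Rightarrow> bool" where
  "rational_triangle T \<longleftrightarrow> (\<forall>s \<in># side_lengths T. s \<in> \<rat>)"

text \<open>Here \<open>\<rho>\<close> is the cosine: \<open>arccos \<rho>\<close> is the angle \<open>\<theta>\<close> of a \<open>\<theta>\<close>-triangle.\<close>

definition theta_triangle :: "real \<Rightarrow> triangle \<Rightarrow> bool" where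
  "theta_triangle \<rho> T \<longleftrightarrow> rational_triangle T \<and> has_angle (arccos \<rho>) T"

definition genuine_pair :: "real \<Rightarrow> triangle \<times> triangle \<Rightarrow> bool" where
  "genuine_pair \<rho> = (\<lambda>(T, I).
     \<rho> \<in> \<rat> \<and> - 1 < \<rho> \<and> \<rho> < 1 \<and>
     nondegenerate T \<and> nondegenerate I \<and>
     rational_triangle T \<and> rational_triangle I \<and>
     theta_triangle \<rho> T \<and> isosceles I \<and>
     perimeter T = perimeter I \<and> area T = area I \<and>
     \<not> congruent_triangles T I)"

definition same_pair :: "triangle \<times> triangle \<Rightarrow> triangle \<times> triangle \<Rightarrow> bool" where
  "same_pair = (\<lambda>(T, I) (T', I').
     \<exists>\<mu>>0. congruent_triangles T' (scale_triangle \<mu> T) \<and>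
           congruent_triangles I' (scale_triangle \<mu> I))"

type_synonym sides = "real \<times> real \<times> real"

definition has_sides :: "triangle \<Rightarrow> sides \<Rightarrow> bool" where
  "has_sides T = (\<lambda>(a, b, c). side_lengths T = {#a, b, c#})"

text \<open>\<open>Ps\<close> consists of \<open>n\<close> distinct genuine pairs for \<open>\<rho>\<close>, realizing in the plane the pairs
  of side length triples in \<open>L\<close>.\<close>

definition distinct_genuine_pairs ::
    "real \<Rightarrow> nat \<Rightarrow> (sides \<times> sides) list \<Rightarrow> (triangle \<times> triangle) list \<Rightarrow> bool" where
  "distinct_genuine_pairs \<rho> n L Ps \<longleftrightarrow>
     length Ps = n \<and>
     list_all2 (\<lambda>(T, I) (t, i). has_sides T t \<and> has_sides I i) Ps L \<and>
     (\<forall>P \<in> set Ps. genuine_pair \<rho> P) \<and>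
     (\<forall>i<n. \<forall>j<n. i \<noteq> j \<longrightarrow> \<not> same_pair (Ps ! i) (Ps ! j))"

definition theta_triangles_noncongruent :: "(triangle \<times> triangle) list \<Rightarrow> bool" where
  "theta_triangles_noncongruent Ps \<longleftrightarrow>
     (\<forall>i<length Ps. \<forall>j<length Ps. i \<noteq> j \<longrightarrow>
        (\<forall>p>0. \<not> congruent_triangles (rescale_to_perimeter p (fst (Ps ! i)))
                                      (rescale_to_perimeter p (fst (Ps ! j)))))"

definition theta_triangle_shared :: "(triangle \<times> triangle) list \<Rightarrow> bool" where
  "theta_triangle_shared Ps \<longleftrightarrow>
     (\<exists>i<length Ps. \<exists>j<length Ps. i \<noteq> j \<and>
        (\<forall>p>0. congruent_triangles (rescale_to_perimeter p (fst (Ps ! i)))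
                                    (rescale_to_perimeter p (fst (Ps ! j))) \<and>
               \<not> congruent_triangles (rescale_to_perimeter p (snd (Ps ! i)))
                                      (rescale_to_perimeter p (snd (Ps ! j)))))"

end

theory Submission
  imports Defs
begin

text \<open>Everything in sight is determined by side lengths. Three positive numbers
  \<open>a \<le> b \<le> c\<close> with \<open>c < a + b\<close> are the sides of an explicit nondegenerate triangle in the
  plane. By Heron's formula its area, and by the law of cosines the cosines of its angles, are
  functions of \<open>a\<close>, \<open>b\<close>, \<open>c\<close>, and the identities that make a listed pair genuine (equal
  perimeters, equal values of \<open>16 * area\<^sup>2\<close>, and \<open>\<rho>\<close> among the three cosines) involve only
  integers or rationals, so that they can be checked by computation
  (\<open>genuine_pair_triangle_of_sides\<close>).

  For distinctness, congruent triangles have the same multiset of sides, hence the same sorted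
  triple. If two triangles become congruent after scaling, their sorted triples are therefore
  proportional (\<open>congruent_scaled_imp_proportional\<close>), and proportionality of integer triples is
  decided by cross multiplication. Two pairs at possibly different scales thus differ as soon as
  their \<open>\<theta>\<close>-triangles or their isosceles triangles have nonproportional triples.

  For a shared \<open>\<theta>\<close>-triangle, congruence has to be established. In each such case
  one listed triple is a multiple of the other, and the explicit triangle is
  homogeneous in its sides, so the two triangles even coincide once they are rescaled to a
  common perimeter.\<close>

section \<open>Congruence and scaling\<close>

text \<open>Vertices may coincide in \<open>T\<close>, but a set of at most two points still
  determines the side lengths: with \<open>d\<close> the distance of the points, they are \<open>0, d, d\<close>.\<close>

lemma side_lengths_cong_vertices:
  assumes "vertices T = vertices T'"
  shows "side_lengths T = side_lengths T'"
proof (cases T; cases T')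
  fix A B C A' B' C' assume T: "T = (A, B, C)" "T' = (A', B', C')"
  then have "{A, B, C} = {A', B', C'}" using assms by simp
  then have "A \<in> {A', B', C'}" "B \<in> {A', B', C'}" "C \<in> {A', B', C'}"
    "A' \<in> {A, B, C}" "B' \<in> {A, B, C}" "C' \<in> {A, B, C}" by blast+
  then show ?thesis
    unfolding T by (auto simp: dist_commute add_mset_commute)
qed

lemma side_lengths_cong_congruent:
  assumes "congruent_triangles T T'"
  shows "side_lengths T = side_lengths T'"
proof (cases T)
  case (fields A B C)
  from assms obtain f :: "real ^ 2 \<Rightarrow> real ^ 2"
    where f: "\<And>x y. dist (f x) (f y) = dist x y" and im: "f ` vertices T = vertices T'"
    unfolding congruent_triangles_def by blast
  have "side_lengths T = side_lengths (f A, f B, f C)"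
    by (simp add: fields f)
  also have "\<dots> = side_lengths T'"
    using im by (intro side_lengths_cong_vertices) (simp add: fields)
  finally show ?thesis .
qed

lemma side_lengths_scale_triangle:
  "side_lengths (scale_triangle \<mu> T) = image_mset ((*) \<bar>\<mu>\<bar>) (side_lengths T)"
  by (cases T) (simp add: dist_norm flip: scaleR_diff_right)

lemma perimeter_eq_sum_side_lengths: "perimeter T = sum_mset (side_lengths T)"
  by (cases T) simp

lemma perimeter_scale_triangle: "perimeter (scale_triangle \<mu> T) = \<bar>\<mu>\<bar> * perimeter T"
  by (cases T) (simp add: dist_norm algebra_simps flip: scaleR_diff_right)

lemma rescale_to_perimeter_scale_triangle:
  assumes "\<mu> > 0"
  shows "rescale_to_perimeter p (scale_triangle \<mu> T) = rescale_to_perimeter p T"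
proof -
  have "scale_triangle r (scale_triangle \<mu> T) = scale_triangle (r * \<mu>) T" for r
    by (cases T) simp
  then show ?thesis
    using assms by (simp add: rescale_to_perimeter_def perimeter_scale_triangle)
qed

lemma congruent_triangles_refl: "congruent_triangles T T"
  unfolding congruent_triangles_def by (intro exI[of _ "\<lambda>x. x"]) simp

section \<open>Sorted triples of sides\<close>

text \<open>Sorting makes the triple a function of the congruence class, and then a single triangle
  inequality suffices.\<close>

fun sorted_sides :: "sides \<Rightarrow> bool" where
  "sorted_sides (a, b, c) \<longleftrightarrow> 0 < a \<and> a \<le> b \<and> b \<le> c \<and> c < a + b"

fun scale_sides :: "real \<Rightarrow> sides \<Rightarrow> sides" where
  "scale_sides \<mu> (a, b, c) = (\<mu> * a, \<mu> * b, \<mu> * c)"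

text \<open>Cross multiplication avoids division and a choice of scaling factor. It expresses
  proportionality because the sides are nonzero; the third
  equation \<open>a * c' = a' * c\<close> then follows from the other two.\<close>

fun proportional :: "sides \<Rightarrow> sides \<Rightarrow> bool" where
  "proportional (a, b, c) (a', b', c') \<longleftrightarrow> a * b' = a' * b \<and> b * c' = b' * c"

lemma proportional_sym: "proportional s t \<Longrightarrow> proportional t s"
  by (cases s; cases t) (auto simp: mult.commute)

lemma sorted_triple_unique:
  fixes a b c :: "'a :: linorder"
  assumes "{#a, b, c#} = {#a', b', c'#}"
    and "a \<le> b" "b \<le> c" "a' \<le> b'" "b' \<le> c'"
  shows "a = a' \<and> b = b' \<and> c = c'"
proof -
  have "sort [a', b', c'] = [a, b, c]" "sort [a', b', c'] = [a', b', c']"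
    using assms by (intro properties_for_sort; simp)+
  then show ?thesis by simp
qed

lemma congruent_imp_sorted_sides_eq:
  assumes "has_sides T s" "has_sides T' s'" "sorted_sides s" "sorted_sides s'"
    and "congruent_triangles T T'"
  shows "s = s'"
proof (cases s; cases s')
  fix a b c a' b' c' assume s: "s = (a, b, c)" "s' = (a', b', c')"
  show ?thesis
    using sorted_triple_unique[of a b c a' b' c'] assms side_lengths_cong_congruent[of T T']
    by (simp add: s has_sides_def)
qed

lemma has_sides_scale_triangle:
  assumes "has_sides T s" "\<mu> > 0"
  shows "has_sides (scale_triangle \<mu> T) (scale_sides \<mu> s)"
  using assms by (cases s) (simp add: has_sides_def side_lengths_scale_triangle)

lemma sorted_sides_scale:
  assumes "sorted_sides s" "\<mu> > 0"
  shows "sorted_sides (scale_sides \<mu> s)"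
  using assms by (cases s) (simp flip: distrib_left)

text \<open>Congruence forces \<open>\<mu> * a = \<nu> * a'\<close>, and likewise for \<open>b\<close> and \<open>c\<close>; eliminating the
  factors leaves the cross products.\<close>

lemma congruent_scaled_imp_proportional:
  assumes "congruent_triangles (scale_triangle \<mu> T) (scale_triangle \<nu> T')"
    and "\<mu> > 0" "\<nu> > 0"
    and "has_sides T s" "has_sides T' s'" "sorted_sides s" "sorted_sides s'"
  shows "proportional s s'"
proof (cases s; cases s')
  fix a b c a' b' c' assume s: "s = (a, b, c)" "s' = (a', b', c')"
  have "scale_sides \<mu> s = scale_sides \<nu> s'"
    using assms
    by (intro congruent_imp_sorted_sides_eq[of "scale_triangle \<mu> T" _ "scale_triangle \<nu> T'"]
        has_sides_scale_triangle sorted_sides_scale)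
  then have eq: "\<mu> * a = \<nu> * a'" "\<mu> * b = \<nu> * b'" "\<mu> * c = \<nu> * c'"
    by (simp_all add: s)
  have "a = \<nu> / \<mu> * a'" "b = \<nu> / \<mu> * b'" "c = \<nu> / \<mu> * c'"
    using eq \<open>\<mu> > 0\<close> by (simp_all add: field_simps)
  then show ?thesis by (simp add: s)
qed

lemma sorted_sides_perimeter_pos:
  assumes "has_sides T s" "sorted_sides s"
  shows "perimeter T > 0"
  using assms by (cases s) (auto simp: perimeter_eq_sum_side_lengths has_sides_def)

lemma congruent_rescaled_imp_proportional:
  assumes "congruent_triangles (rescale_to_perimeter p T) (rescale_to_perimeter p T')"
    and "p > 0"
    and "has_sides T s" "has_sides T' s'" "sorted_sides s" "sorted_sides s'"
  shows "proportional s s'"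
  using congruent_scaled_imp_proportional[OF assms(1)[unfolded rescale_to_perimeter_def]]
    assms sorted_sides_perimeter_pos by simp

text \<open>The common factor of the two triangles in a pair is forgotten here. As \<open>T\<close> and \<open>I\<close> have
  equal perimeter in a genuine pair, no information is lost: proportionality of the triples
  already fixes the factor as the ratio of the perimeters.\<close>

lemma same_pair_imp_proportional:
  assumes "same_pair (T, I) (T', I')"
    and "has_sides T t" "has_sides T' t'" "sorted_sides t" "sorted_sides t'"
    and "has_sides I i" "has_sides I' i'" "sorted_sides i" "sorted_sides i'"
  shows "proportional t t' \<and> proportional i i'"
proof -
  have [simp]: "scale_triangle 1 X = X" for X by (cases X) simp
  obtain \<mu> where \<mu>: "\<mu> > 0" "congruent_triangles T' (scale_triangle \<mu> T)"
    "congruent_triangles I' (scale_triangle \<mu> I)"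
    using assms(1) by (auto simp: same_pair_def)
  have "proportional t' t" "proportional i' i"
    using congruent_scaled_imp_proportional[of 1 T' \<mu> T t' t]
      congruent_scaled_imp_proportional[of 1 I' \<mu> I i' i] assms \<mu> by simp_all
  then show ?thesis by (simp add: proportional_sym)
qed

section \<open>Realizing a triple of sides in the plane\<close>

lemma angle_at_law_of_cosines:
  "angle_at A B C = arccos (((dist A B)\<^sup>2 + (dist A C)\<^sup>2 - (dist B C)\<^sup>2) / (2 * dist A B * dist A C))"
proof -
  have "(dist B C)\<^sup>2 = (dist A B)\<^sup>2 + (dist A C)\<^sup>2 - 2 * ((B - A) \<bullet> (C - A))"
    by (simp add: dist_norm power2_norm_eq_inner algebra_simps inner_commute)
  then show ?thesis
    by (simp add: angle_at_def dist_norm norm_minus_commute)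
qed

definition cosine_between :: "real \<Rightarrow> real \<Rightarrow> real \<Rightarrow> real" where
  "cosine_between a b c = (a\<^sup>2 + b\<^sup>2 - c\<^sup>2) / (2 * a * b)"

fun cosines :: "sides \<Rightarrow> real set" where
  "cosines (a, b, c) = {cosine_between a b c, cosine_between b c a, cosine_between c a b}"

text \<open>The side of length \<open>a\<close> lies on the first axis with one end at the origin. The third vertex
  is at distance \<open>c\<close> from the origin, and \<open>x\<close>, its first coordinate, is \<open>c\<close> times the cosine of
  the angle at the origin.\<close>

fun triangle_of_sides :: "sides \<Rightarrow> triangle" where
  "triangle_of_sides (a, b, c) =
     (let x = (a\<^sup>2 + c\<^sup>2 - b\<^sup>2) / (2 * a)
      in (0, vector [a, 0], vector [x, sqrt (c\<^sup>2 - x\<^sup>2)]))"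

text \<open>Homogeneity of the construction replaces the congruence theorem for triangles with equal
  sides: it turns a shared shape into equality of the rescaled triangles.\<close>

lemma triangle_of_sides_scale:
  assumes "\<mu> > 0"
  shows "triangle_of_sides (scale_sides \<mu> s) = scale_triangle \<mu> (triangle_of_sides s)"
proof (cases s)
  case (fields a b c)
  define x where "x = (a\<^sup>2 + c\<^sup>2 - b\<^sup>2) / (2 * a)"
  have x: "((\<mu> * a)\<^sup>2 + (\<mu> * c)\<^sup>2 - (\<mu> * b)\<^sup>2) / (2 * (\<mu> * a)) = \<mu> * x"
    using assms by (simp add: x_def power_mult_distrib power2_eq_square divide_simps) (simp add: algebra_simps)
  have y: "sqrt ((\<mu> * c)\<^sup>2 - (\<mu> * x)\<^sup>2) = \<mu> * sqrt (c\<^sup>2 - x\<^sup>2)"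
    using assms by (simp add: power_mult_distrib real_sqrt_mult flip: right_diff_distrib)
  show ?thesis
    by (simp add: fields x y Let_def x_def[symmetric] vec_eq_iff forall_2)
qed

lemma dist_real2: "dist (u :: real ^ 2) v = sqrt ((u $ 1 - v $ 1)\<^sup>2 + (u $ 2 - v $ 2)\<^sup>2)"
  by (simp add: dist_vec_def L2_set_def sum_2 dist_real_def)

lemma triangle_of_sides_dist:
  assumes "sorted_sides (a, b, c)"
  obtains A B C where "triangle_of_sides (a, b, c) = (A, B, C)"
    "dist A B = a" "dist B C = b" "dist C A = c"
proof -
  define x where "x = (a\<^sup>2 + c\<^sup>2 - b\<^sup>2) / (2 * a)"
  define y where "y = sqrt (c\<^sup>2 - x\<^sup>2)"
  have pos: "a > 0" "b > 0" "c > 0" using assms by auto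
  have ax: "2 * a * x = a\<^sup>2 + c\<^sup>2 - b\<^sup>2" using pos by (simp add: x_def)
  \<comment> \<open>The radicand of the second coordinate is nonnegative since \<open>4 * a\<^sup>2\<close> times it is Heron's
    product.\<close>
  have "4 * a\<^sup>2 * (c\<^sup>2 - x\<^sup>2) = 4 * a\<^sup>2 * c\<^sup>2 - (2 * a * x)\<^sup>2"
    by (simp add: algebra_simps power2_eq_square)
  also have "\<dots> = (a + b + c) * (a + b - c) * (b + c - a) * (c + a - b)"
    unfolding ax by (simp add: algebra_simps power2_eq_square)
  also have "\<dots> \<ge> 0" using assms by auto
  finally have "c\<^sup>2 - x\<^sup>2 \<ge> 0" using pos by (simp add: zero_le_mult_iff)
  then have y: "y\<^sup>2 = c\<^sup>2 - x\<^sup>2" by (simp add: y_def)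
  have "(a - x)\<^sup>2 + y\<^sup>2 = b\<^sup>2"
    using ax unfolding y by (simp add: algebra_simps power2_eq_square)
  then show thesis
    using pos y that[of 0 "vector [a, 0]" "vector [x, y]"]
    by (simp add: x_def[symmetric] y_def[symmetric] dist_real2 Let_def)
qed

text \<open>Heron's product without halved perimeters, so that integer sides give an integer.\<close>

fun sixteen_area_squared :: "sides \<Rightarrow> real" where
  "sixteen_area_squared (a, b, c) = (a + b + c) * (a + b - c) * (b + c - a) * (c + a - b)"

lemma area_heron:
  "area (A, B, C) = sqrt (sixteen_area_squared (dist A B, dist B C, dist C A)) / 4"
proof -
  define a b c where "a = dist A B" and "b = dist B C" and "c = dist C A"
  define s where "s = (a + b + c) / 2"
  have "area (A, B, C) = sqrt (s * (s - b) * (s - c) * (s - a))"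
    using heron[of A B C] by (simp add: s_def a_def b_def c_def dist_commute add.commute add.left_commute)
  also have "s * (s - b) * (s - c) * (s - a) = sixteen_area_squared (a, b, c) / 4\<^sup>2"
    by (simp add: s_def field_simps power2_eq_square)
  also have "sqrt \<dots> = sqrt (sixteen_area_squared (a, b, c)) / 4"
    by (simp add: real_sqrt_divide)
  finally show ?thesis by (simp add: a_def b_def c_def)
qed

fun sides_perimeter :: "sides \<Rightarrow> real" where
  "sides_perimeter (a, b, c) = a + b + c"

fun rational_sides :: "sides \<Rightarrow> bool" where
  "rational_sides (a, b, c) \<longleftrightarrow> a \<in> \<rat> \<and> b \<in> \<rat> \<and> c \<in> \<rat>"

text \<open>In a sorted triple, equality of the outer entries would make all three equal.\<close>

fun isosceles_sides :: "sides \<Rightarrow> bool" where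
  "isosceles_sides (a, b, c) \<longleftrightarrow> a = b \<or> b = c"

lemma triangle_of_sides_properties:
  assumes "sorted_sides s"
  shows has_sides_triangle_of_sides: "has_sides (triangle_of_sides s) s"
    and nondegenerate_triangle_of_sides: "nondegenerate (triangle_of_sides s)"
    and rational_triangle_of_sides: "rational_sides s \<Longrightarrow> rational_triangle (triangle_of_sides s)"
    and isosceles_triangle_of_sides: "isosceles_sides s \<Longrightarrow> isosceles (triangle_of_sides s)"
    and perimeter_triangle_of_sides: "perimeter (triangle_of_sides s) = sides_perimeter s"
    and area_triangle_of_sides:
      "area (triangle_of_sides s) = sqrt (sixteen_area_squared s) / 4"
    and has_angle_triangle_of_sides:
      "\<rho> \<in> cosines s \<Longrightarrow> has_angle (arccos \<rho>) (triangle_of_sides s)"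
proof -
  obtain a b c where s: "s = (a, b, c)" by (cases s)
  obtain A B C where T: "triangle_of_sides s = (A, B, C)"
    and d: "dist A B = a" "dist B C = b" "dist C A = c"
    using triangle_of_sides_dist assms unfolding s by metis
  have d': "dist B A = a" "dist C B = b" "dist A C = c" using d by (simp_all add: dist_commute)
  show "has_sides (triangle_of_sides s) s"
    unfolding T by (simp add: has_sides_def s d)
  \<comment> \<open>Among collinear points one lies between the others, which would turn a triangle inequality
    into an equality.\<close>
  show "nondegenerate (triangle_of_sides s)"
    unfolding T using assms by (auto simp: s d d' collinear_between_cases between)
  show "rational_sides s \<Longrightarrow> rational_triangle (triangle_of_sides s)"
    unfolding T by (simp add: rational_triangle_def s d)
  show "isosceles_sides s \<Longrightarrow> isosceles (triangle_of_sides s)"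
    unfolding T by (auto simp: s d d')
  show "perimeter (triangle_of_sides s) = sides_perimeter s"
    unfolding T by (simp add: s d)
  show "area (triangle_of_sides s) = sqrt (sixteen_area_squared s) / 4"
    unfolding T area_heron by (simp only: s d)
  show "\<rho> \<in> cosines s \<Longrightarrow> has_angle (arccos \<rho>) (triangle_of_sides s)"
    unfolding T by (auto simp: s d d' angle_at_law_of_cosines cosine_between_def mult_ac add.commute)
qed

section \<open>Lists of genuine pairs from arithmetic\<close>

text \<open>The arithmetic content of a genuine pair. Sorted triples that differ
  give triangles that are not congruent.\<close>

fun genuine_sides :: "real \<Rightarrow> sides \<times> sides \<Rightarrow> bool" where
  "genuine_sides \<rho> (t, i) \<longleftrightarrow>
     sorted_sides t \<and> sorted_sides i \<and> rational_sides t \<and> rational_sides i \<and>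
     \<rho> \<in> cosines t \<and> isosceles_sides i \<and> t \<noteq> i \<and>
     sides_perimeter t = sides_perimeter i \<and> sixteen_area_squared t = sixteen_area_squared i"

lemma genuine_pair_triangle_of_sides:
  assumes "genuine_sides \<rho> (t, i)" "\<rho> \<in> \<rat>" "- 1 < \<rho>" "\<rho> < 1"
  shows "genuine_pair \<rho> (triangle_of_sides t, triangle_of_sides i)"
proof -
  have ord: "sorted_sides t" "sorted_sides i" using assms by auto
  then have "\<not> congruent_triangles (triangle_of_sides t) (triangle_of_sides i)"
    using congruent_imp_sorted_sides_eq[OF has_sides_triangle_of_sides has_sides_triangle_of_sides] assms(1)
    by simp blast
  then show ?thesis
    using assms ord
    by (simp add: genuine_pair_def theta_triangle_def triangle_of_sides_properties)
qed

abbreviation triangles_of_pair :: "sides \<times> sides \<Rightarrow> triangle \<times> triangle" where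
  "triangles_of_pair \<equiv> map_prod triangle_of_sides triangle_of_sides"

lemma sorted_wrt_symD:
  assumes "sorted_wrt R xs" "\<And>x y. R x y \<Longrightarrow> R y x" "i < length xs" "j < length xs" "i \<noteq> j"
  shows "R (xs ! i) (xs ! j)"
  using assms unfolding sorted_wrt_iff_nth_less by (metis linorder_neqE_nat)

text \<open>Proportionality is symmetric, so only the pairs of entries at positions \<open>j < k\<close> have to be
  tested, which \<open>sorted_wrt\<close> does and which simplification unfolds on an explicit list.\<close>

lemma distinct_genuine_pairs_triangles_of_pair:
  assumes \<rho>: "\<rho> \<in> \<rat>" "- 1 < \<rho>" "\<rho> < 1"
    and gen: "\<forall>P \<in> set L. genuine_sides \<rho> P"
    and dist: "sorted_wrt (\<lambda>(t, i) (t', i'). \<not> (proportional t t' \<and> proportional i i')) L"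
    and n: "n = length L"
  shows "distinct_genuine_pairs \<rho> n L (map triangles_of_pair L)"
proof -
  have sides: "has_sides (triangle_of_sides t) t \<and> has_sides (triangle_of_sides i) i"
    and gp: "genuine_pair \<rho> (triangle_of_sides t, triangle_of_sides i)"
    if "(t, i) \<in> set L" for t i
  proof -
    have G: "genuine_sides \<rho> (t, i)" using gen that by blast
    then show "has_sides (triangle_of_sides t) t \<and> has_sides (triangle_of_sides i) i"
      by (simp add: has_sides_triangle_of_sides)
    show "genuine_pair \<rho> (triangle_of_sides t, triangle_of_sides i)"
      using G \<rho> by (rule genuine_pair_triangle_of_sides)
  qed
  have "\<not> same_pair (triangles_of_pair (L ! j)) (triangles_of_pair (L ! k))"
    if jk: "j < n" "k < n" "j \<noteq> k" for j k
  proof -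
    obtain t i t' i' where L: "L ! j = (t, i)" "L ! k = (t', i')" by (metis surj_pair)
    have "(t, i) \<in> set L" "(t', i') \<in> set L" using jk n L by (metis nth_mem)+
    then have "genuine_sides \<rho> (t, i)" "genuine_sides \<rho> (t', i')"
      using gen by blast+
    then have ord: "sorted_sides t" "sorted_sides i" "sorted_sides t'" "sorted_sides i'"
      by simp_all
    have "\<not> (proportional t t' \<and> proportional i i')"
      using sorted_wrt_symD[OF dist, of j k] jk n L proportional_sym by fastforce
    then show ?thesis
      using same_pair_imp_proportional[of "triangle_of_sides t" "triangle_of_sides i"
          "triangle_of_sides t'" "triangle_of_sides i'" t t' i i']
      by (auto simp: L has_sides_triangle_of_sides ord)
  qed
  moreover have "list_all2 (\<lambda>(T, I) (t, i). has_sides T t \<and> has_sides I i) (map triangles_of_pair L) L"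
    using sides nth_mem by (fastforce simp: list_all2_conv_all_nth)
  ultimately show ?thesis
    using gp n by (auto simp: distinct_genuine_pairs_def)
qed

lemma theta_triangles_noncongruent_triangles_of_pair:
  assumes gen: "\<forall>P \<in> set L. genuine_sides \<rho> P"
    and dist: "sorted_wrt (\<lambda>(t, i) (t', i'). \<not> proportional t t') L"
  shows "theta_triangles_noncongruent (map triangles_of_pair L)"
  unfolding theta_triangles_noncongruent_def length_map
proof (intro allI impI)
  fix j k and p :: real
  assume jk: "j < length L" "k < length L" "j \<noteq> k" and p: "p > 0"
  obtain t i t' i' where L: "L ! j = (t, i)" "L ! k = (t', i')" by (metis surj_pair)
  have "(t, i) \<in> set L" "(t', i') \<in> set L" using jk L by (metis nth_mem)+
  then have "genuine_sides \<rho> (t, i)" "genuine_sides \<rho> (t', i')"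
    using gen by blast+
  then have ord: "sorted_sides t" "sorted_sides t'" by simp_all
  have nprop: "\<not> proportional t t'"
    using sorted_wrt_symD[OF dist, of j k] jk L proportional_sym by fastforce
  show "\<not> congruent_triangles
      (rescale_to_perimeter p (fst (map triangles_of_pair L ! j)))
      (rescale_to_perimeter p (fst (map triangles_of_pair L ! k)))"
    using congruent_rescaled_imp_proportional[OF _ p, of "triangle_of_sides t"
        "triangle_of_sides t'" t t'] ord nprop jk
    by (auto simp: L has_sides_triangle_of_sides)
qed

text \<open>The factor \<open>\<mu>\<close> accounts for a shared \<open>\<theta>\<close>-triangle that is listed at two scales.\<close>

lemma theta_triangle_shared_triangles_of_pair:
  assumes gen: "\<forall>P \<in> set L. genuine_sides \<rho> P"
    and jk: "j < length L" "k < length L" "j \<noteq> k"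
    and \<mu>: "\<mu> > 0" "fst (L ! j) = scale_sides \<mu> (fst (L ! k))"
    and dist: "\<not> proportional (snd (L ! j)) (snd (L ! k))"
  shows "theta_triangle_shared (map triangles_of_pair L)"
  unfolding theta_triangle_shared_def length_map
proof (rule exI[of _ j], intro conjI jk exI[of _ k] allI impI)
  fix p :: real assume p: "p > 0"
  obtain t i t' i' where L: "L ! j = (t, i)" "L ! k = (t', i')" by (metis surj_pair)
  have "(t, i) \<in> set L" "(t', i') \<in> set L" using jk L by (metis nth_mem)+
  then have "genuine_sides \<rho> (t, i)" "genuine_sides \<rho> (t', i')"
    using gen by blast+
  then have ord: "sorted_sides i" "sorted_sides i'" by simp_all
  show "congruent_triangles
      (rescale_to_perimeter p (fst (map triangles_of_pair L ! j)))
      (rescale_to_perimeter p (fst (map triangles_of_pair L ! k)))"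
    using jk \<mu> by (simp add: L triangle_of_sides_scale rescale_to_perimeter_scale_triangle
        congruent_triangles_refl)
  show "\<not> congruent_triangles
      (rescale_to_perimeter p (snd (map triangles_of_pair L ! j)))
      (rescale_to_perimeter p (snd (map triangles_of_pair L ! k)))"
    using congruent_rescaled_imp_proportional[OF _ p, of "triangle_of_sides i"
        "triangle_of_sides i'" i i'] ord dist jk
    by (auto simp: L has_sides_triangle_of_sides)
qed

text \<open>The following two rules have premises that are decidable by simplification for concrete
  numbers; nonproportional \<open>\<theta>\<close>-triangles already make the pairs distinct.\<close>

lemma Ex_triangles_noncongruent:
  assumes "\<rho> \<in> \<rat>" "- 1 < \<rho>" "\<rho> < 1" "n = length L"
    and gen: "\<forall>P \<in> set L. genuine_sides \<rho> P"
    and dist: "sorted_wrt (\<lambda>(t, i) (t', i'). \<not> proportional t t') L"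
  shows "\<exists>Ps. distinct_genuine_pairs \<rho> n L Ps \<and> theta_triangles_noncongruent Ps"
proof (intro exI conjI)
  have "sorted_wrt (\<lambda>(t, i) (t', i'). \<not> (proportional t t' \<and> proportional i i')) L"
    by (rule sorted_wrt_mono_rel[OF _ dist]) auto
  then show "distinct_genuine_pairs \<rho> n L (map triangles_of_pair L)"
    using assms by (intro distinct_genuine_pairs_triangles_of_pair)
  show "theta_triangles_noncongruent (map triangles_of_pair L)"
    using assms by (intro theta_triangles_noncongruent_triangles_of_pair)
qed

lemma Ex_triangles_shared:
  assumes "\<rho> \<in> \<rat>" "- 1 < \<rho>" "\<rho> < 1" "n = length L"
    and "\<forall>P \<in> set L. genuine_sides \<rho> P"
    and "sorted_wrt (\<lambda>(t, i) (t', i'). \<not> (proportional t t' \<and> proportional i i')) L"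
    and "j < length L" "k < length L" "j \<noteq> k"
    and "\<mu> > 0" "fst (L ! j) = scale_sides \<mu> (fst (L ! k))"
    and "\<not> proportional (snd (L ! j)) (snd (L ! k))"
  shows "\<exists>Ps. distinct_genuine_pairs \<rho> n L Ps \<and> theta_triangle_shared Ps"
  using assms distinct_genuine_pairs_triangles_of_pair theta_triangle_shared_triangles_of_pair
  by blast

section \<open>The listed values of \<open>\<rho>\<close>\<close>

theorem proposition9p5:
  shows
    "(\<exists>Ps. distinct_genuine_pairs (1952 / 3977) 6
        [((12064, 86193, 91471), (10764, 89482, 89482)),
         ((3977, 4215, 4352), (3960, 4292, 4292)),
         ((1261, 1299, 1312), (1260, 1306, 1306)),
         ((970, 984, 986), (975, 975, 990)),
         ((7178, 8010, 8528), (7529, 7529, 8658)),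
         ((14145, 21089, 24056), (17225, 17225, 24840))] Ps \<and>
      theta_triangles_noncongruent Ps) \<and>
     (\<exists>Ps. distinct_genuine_pairs (613 / 1495) 5
        [((1058, 1533, 1625), (1050, 1583, 1583)),
         ((525, 598, 613), (553, 553, 630)),
         ((598, 750, 760), (655, 655, 798)),
         ((299, 389, 400), (334, 334, 420)),
         ((299, 805, 880), (530, 530, 924))] Ps \<and>
      theta_triangles_noncongruent Ps) \<and>
     (\<exists>Ps. distinct_genuine_pairs (817 / 1969) 5
        [((1268608, 1406403, 1451453), (1322928, 1322928, 1480608)),
         ((1634, 1969, 1969), (1754, 1754, 2064)),
         ((1122, 2123, 2327), (1562, 1562, 2448)),
         ((57101, 138774, 152375), (94085, 94085, 160080)),
         ((1029, 1804, 1969), (1008, 1897, 1897))] Ps \<and>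
      theta_triangles_noncongruent Ps) \<and>
     (\<exists>Ps. distinct_genuine_pairs (7671 / 16121) 5
        [((4823, 73826, 75999), (4290, 75179, 75179)),
         ((3773, 4034, 4089), (3770, 4063, 4063)),
         ((1960, 1974, 2014), (1950, 1999, 1999)),
         ((123850881, 329543125, 369951946), (219139063, 219139063, 385067826)),
         ((31311875, 32603571, 32739554), (31771675, 31771675, 33111650))] Ps \<and>
      theta_triangles_noncongruent Ps) \<and>
     (\<exists>Ps. distinct_genuine_pairs (302 / 527) 5
        [((2108, 2787, 3395), (1940, 3175, 3175)),
         ((578, 1250, 1488), (893, 893, 1530)),
         ((8385, 8959, 9184), (8364, 9082, 9082)),
         ((8160, 8479, 9889), (8314, 8314, 9900)),
         ((855117, 871133, 1007500), (807300, 963225, 963225))] Ps \<and>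
      theta_triangles_noncongruent Ps) \<and>
     (\<exists>Ps. distinct_genuine_pairs (2619 / 5069) 6
        [((822, 1394, 1628), (770, 1537, 1537)),
         ((411, 697, 814), (541, 541, 840)),
         ((555, 4397, 4658), (2425, 2425, 4760)),
         ((2270333, 2297216, 2320899), (2266824, 2310812, 2310812)),
         ((2322, 24227, 25345), (13047, 13047, 25800)),
         ((1378768, 1532129, 1689039), (1346268, 1626834, 1626834))] Ps \<and>
      theta_triangle_shared Ps) \<and>
     (\<exists>Ps. distinct_genuine_pairs (- (327 / 1241)) 5
        [((612, 1387, 1657), (532, 1562, 1562)),
         ((219, 289, 406), (168, 373, 373)),
         ((219, 289, 406), (253, 253, 408)),
         ((4891, 8721, 11066), (6711, 6711, 11256)),
         ((73, 408, 433), (233, 233, 448))] Ps \<and>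
      theta_triangle_shared Ps) \<and>
     (\<exists>Ps. distinct_genuine_pairs (2341 / 4141) 5
        [((1681, 2175, 2626), (1560, 2461, 2461)),
         ((3362, 4350, 5252), (3817, 3817, 5330)),
         ((295, 303, 328), (288, 319, 319)),
         ((1066, 2487, 2929), (1733, 1733, 3016)),
         ((1704375, 1963667, 2334458), (1824725, 1824725, 2353050))] Ps \<and>
      theta_triangle_shared Ps) \<and>
     (\<exists>Ps. distinct_genuine_pairs (171 / 221) 5
        [((25, 34, 39), (24, 37, 37)),
         ((25, 34, 39), (29, 29, 40)),
         ((173, 195, 272), (140, 250, 250)),
         ((43289, 59895, 67184), (50534, 50534, 69300)),
         ((701250, 816877, 1228123), (758225, 758225, 1229800))] Ps \<and>
      theta_triangle_shared Ps)"
proof (intro conjI, goal_cases)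
  case 1 show ?case by (rule Ex_triangles_noncongruent) (simp_all add: cosine_between_def)
next
  case 2 show ?case by (rule Ex_triangles_noncongruent) (simp_all add: cosine_between_def)
next
  case 3 show ?case by (rule Ex_triangles_noncongruent) (simp_all add: cosine_between_def)
next
  case 4 show ?case by (rule Ex_triangles_noncongruent) (simp_all add: cosine_between_def)
next
  case 5 show ?case by (rule Ex_triangles_noncongruent) (simp_all add: cosine_between_def)
next
  \<comment> \<open>In the lists with a shared \<open>\<theta>\<close>-triangle, \<open>j\<close> and \<open>k\<close> are the positions of the two entries
    that share it, and \<open>\<mu>\<close> is the ratio of their scales.\<close>
  case 6 show ?case
    by (rule Ex_triangles_shared[where j = 0 and k = 1 and \<mu> = 2])
      (simp_all add: cosine_between_def)
next
  case 7 show ?case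
    by (rule Ex_triangles_shared[where j = 1 and k = 2 and \<mu> = 1])
      (simp_all add: cosine_between_def)
next
  case 8 show ?case
    by (rule Ex_triangles_shared[where j = 1 and k = 0 and \<mu> = 2])
      (simp_all add: cosine_between_def)
next
  case 9 show ?case
    by (rule Ex_triangles_shared[where j = 0 and k = 1 and \<mu> = 1])
      (simp_all add: cosine_between_def)
qed

end
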